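(* Let $A$ be a closed densely defined symmetric operator with equal deficiency indices in a separable Hilbert space $\mathfrak H$, let $\{\mathcal H,\Gamma_0,\Gamma_1\}$ be a boundary triplet for $A^*$ with Weyl function $M(z)$, and let $A_0=A_0^*$ be the self-adjoint extension of $A$ with $\operatorname{dom}(A_0)=\ker\Gamma_0$. Then $M(z)$ is a $Q$-function of $A$ belonging to the extension $A_0$.
   Context: $[\mathcal H_1,\mathcal H_2]$ denotes bounded everywhere defined operators from $\mathcal H_1$ to $\mathcal H_2$, $[\mathcal H]=[\mathcal H,\mathcal H]$, and $\mathfrak N_z=\ker(A^*-z)$. A boundary triplet for $A^*$ is a triple $\{\mathcal H,\Gamma_0,\Gamma_1\}$, where $\mathcal H$ is a Hilbert space and $\Gamma_0,\Gamma_1:\operatorname{dom}(A^* )\to\mathcal H$ are linear maps such that (i) $(A^*f,g)_{\mathfrak H}-(f,A^*g)_{\mathfrak H}=(\Gamma_1f,\Gamma_0g)_{\mathcal H}-(\Gamma_0f,\Gamma_1g)_{\mathcal H}$ for all $f,g\in\operatorname{dom}(A^* )$, and (ii) $f\mapsto(\Gamma_1f,\Gamma_0f)$ maps $\operatorname{dom}(A^* )$ onto $\mathcal H\oplus\mathcal H$. Its Weyl function is the $[\mathcal H]$-valued function $M(z)$, $z\in\rho(A_0)$, defined by $M(z)\Gamma_0f_z=\Gamma_1f_z$ for $f_z\in\mathfrak N_z$. Let $\widetilde A=\widetilde A^*$ be a self-adjoint extension of $A$ and $\mathcal H$ a Hilbert space whose dimension equals the deficiency number of $A$. A $\gamma$-field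 of $A$ (associated with $\widetilde A$) is a function $\gamma(z)=(\widetilde A-z_0)(\widetilde A-z)^{-1}\gamma(z_0)$, $z\in\rho(\widetilde A)$, where $z_0\in\rho(\widetilde A)$ and $\gamma(z_0)\in[\mathcal H,\mathfrak N_{z_0}]$ has inverse $\gamma(z_0)^{-1}\in[\mathfrak N_{z_0},\mathcal H]$; then $\gamma(z)\in[\mathcal H,\mathfrak N_z]$. An $[\mathcal H]$-valued function $Q(z)$ on $\rho(\widetilde A)$ is called a $Q$-function of $A$ belonging to $\widetilde A$ if, for some such $\gamma$-field, $Q(z)-Q(\zeta)^*=(z-\bar\zeta)\gamma(\zeta)^*\gamma(z)$ for all $z,\zeta\in\rho(\widetilde A)$. *)

theory Defs
  imports "HOL-Analysis.Analysis" "HOL-Library.Equipollence"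
begin

section \<open>Complex Hilbert spaces\<close>

text \<open>
  The real structure is the underlying one of the complex structure: the real inner product is the
  real part of the complex one, so norm and topology are those of the complex inner product.
  The complex inner product is linear in its \<^emph>\<open>first\<close> argument.  Zero-dimensional spaces
  are admitted.
\<close>

class complex_inner = real_inner +
  fixes scaleC :: "complex \<Rightarrow> 'a \<Rightarrow> 'a" (infixr "*\<^sub>C" 75)
    and cinner :: "'a \<Rightarrow> 'a \<Rightarrow> complex"
  assumes scaleC_add_right: "a *\<^sub>C (x + y) = a *\<^sub>C x + a *\<^sub>C y"
    and scaleC_add_left: "(a + b) *\<^sub>C x = a *\<^sub>C x + b *\<^sub>C x"
    and scaleC_scaleC: "a *\<^sub>C (b *\<^sub>C x) = (a * b) *\<^sub>C x"
    and scaleR_scaleC: "r *\<^sub>R x = complex_of_real r *\<^sub>C x"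
    and cinner_commute: "cinner x y = cnj (cinner y x)"
    and cinner_add_left: "cinner (x + y) z = cinner x z + cinner y z"
    and cinner_scaleC_left: "cinner (a *\<^sub>C x) y = a * cinner x y"
    and inner_cinner: "inner x y = Re (cinner x y)"

class chilbert_space = complex_inner + complete_space

instantiation complex :: chilbert_space
begin

definition scaleC_complex :: "complex \<Rightarrow> complex \<Rightarrow> complex"
  where "scaleC_complex a x = a * x"

definition cinner_complex :: "complex \<Rightarrow> complex \<Rightarrow> complex"
  where "cinner_complex x y = x * cnj y"

instance
  by standard
    (auto simp: scaleC_complex_def cinner_complex_def algebra_simps inner_complex_def
      scaleR_conv_of_real)

end

definition separable_hilbert :: "'a::chilbert_space itself \<Rightarrow> bool"
  where "separable_hilbert _ \<longleftrightarrow> (\<exists>D :: 'a set. countable D \<and> closure D = UNIV)"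

text \<open>An orthonormal basis of a closed subspace is a maximal orthonormal subset of it.\<close>

definition orthonormal_basis :: "'a::complex_inner set \<Rightarrow> 'a set \<Rightarrow> bool"
  where "orthonormal_basis S B \<longleftrightarrow>
    B \<subseteq> S \<and>
    (\<forall>b\<in>B. \<forall>c\<in>B. cinner b c = (if b = c then 1 else 0)) \<and>
    (\<forall>x\<in>S. (\<forall>b\<in>B. cinner x b = 0) \<longrightarrow> x = 0)"

definition same_hilbert_dim :: "'a::complex_inner set \<Rightarrow> 'b::complex_inner set \<Rightarrow> bool"
  where "same_hilbert_dim S T \<longleftrightarrow>
    (\<exists>B C. orthonormal_basis S B \<and> orthonormal_basis T C \<and> B \<approx> C)"

definition clinear_on :: "'a::complex_inner set \<Rightarrow> ('a \<Rightarrow> 'b::complex_inner) \<Rightarrow> bool"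
  where "clinear_on S T \<longleftrightarrow>
    (\<forall>x\<in>S. \<forall>y\<in>S. T (x + y) = T x + T y) \<and> (\<forall>c. \<forall>x\<in>S. T (c *\<^sub>C x) = c *\<^sub>C T x)"

text \<open>\<open>T \<in> [S, R]\<close> for subspaces \<open>S\<close> and \<open>R\<close>.\<close>

definition bounded_op :: "'a::complex_inner set \<Rightarrow> 'b::complex_inner set \<Rightarrow> ('a \<Rightarrow> 'b) \<Rightarrow> bool"
  where "bounded_op S R T \<longleftrightarrow>
    clinear_on S T \<and> T ` S \<subseteq> R \<and> (\<exists>K. \<forall>x\<in>S. norm (T x) \<le> K * norm x)"

text \<open>The adjoint of a bounded everywhere defined operator; it exists by the Riesz theorem.\<close>

definition bounded_adjoint :: "('a::complex_inner \<Rightarrow> 'b::complex_inner) \<Rightarrow> 'b \<Rightarrow> 'a"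
  where "bounded_adjoint T y = (THE x. \<forall>h. cinner (T h) y = cinner h x)"


section \<open>Unbounded operators\<close>

text \<open>An unbounded operator is represented by its graph \<open>{(f, A f) | f \<in> dom A}\<close>; thus its domain is
  \<^const>\<open>Domain\<close>, its inverse is \<^const>\<open>converse\<close>, extension is inclusion, and \<open>S T\<close> is \<open>T O S\<close>.\<close>

type_synonym 'a op = "('a \<times> 'a) set"

definition linear_operator :: "'a::complex_inner op \<Rightarrow> bool"
  where "linear_operator A \<longleftrightarrow>
    single_valued A \<and> (0, 0) \<in> A \<and>
    (\<forall>f f' g g'. (f, f') \<in> A \<longrightarrow> (g, g') \<in> A \<longrightarrow> (f + g, f' + g') \<in> A) \<and>
    (\<forall>c f f'. (f, f') \<in> A \<longrightarrow> (c *\<^sub>C f, c *\<^sub>C f') \<in> A)"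

definition densely_defined :: "'a::complex_inner op \<Rightarrow> bool"
  where "densely_defined A \<longleftrightarrow> closure (Domain A) = UNIV"

definition symmetric_operator :: "'a::complex_inner op \<Rightarrow> bool"
  where "symmetric_operator A \<longleftrightarrow>
    (\<forall>f f' g g'. (f, f') \<in> A \<longrightarrow> (g, g') \<in> A \<longrightarrow> cinner f' g = cinner f g')"

definition adj :: "'a::complex_inner op \<Rightarrow> 'a op"
  where "adj A = {(g, g'). \<forall>f f'. (f, f') \<in> A \<longrightarrow> cinner f' g = cinner f g'}"

definition self_adjoint :: "'a::complex_inner op \<Rightarrow> bool"
  where "self_adjoint A \<longleftrightarrow> linear_operator A \<and> densely_defined A \<and> adj A = A"

definition shift :: "'a::complex_inner op \<Rightarrow> complex \<Rightarrow> 'a op"  (* A - z *)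
  where "shift A z = {(f, f' - z *\<^sub>C f) | f f'. (f, f') \<in> A}"

definition kernel :: "'a::complex_inner op \<Rightarrow> 'a set"
  where "kernel A = {f. (f, 0) \<in> A}"

definition restrict_op :: "'a op \<Rightarrow> 'a set \<Rightarrow> 'a op"
  where "restrict_op A S = {(f, f') \<in> A. f \<in> S}"

text \<open>\<open>z\<close> is in the resolvent set iff \<open>(A - z)\<inverse>\<close> is a bounded everywhere defined operator.\<close>

definition resolvent_set :: "'a::complex_inner op \<Rightarrow> complex set"
  where "resolvent_set A =
    {z. \<exists>R. bounded_op UNIV UNIV R \<and> (shift A z)\<inverse> = {(g, R g) | g. True}}"

definition defect_subspace :: "'a::complex_inner op \<Rightarrow> complex \<Rightarrow> 'a set"
  where "defect_subspace A z = kernel (shift (adj A) z)"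

text \<open>The deficiency indices are the dimensions of the defect subspaces at \<open>\<i>\<close> and \<open>- \<i>\<close>.\<close>

definition equal_deficiency_indices :: "'a::complex_inner op \<Rightarrow> bool"
  where "equal_deficiency_indices A \<longleftrightarrow>
    same_hilbert_dim (defect_subspace A \<i>) (defect_subspace A (- \<i>))"

definition dim_eq_deficiency_number :: "'h::complex_inner itself \<Rightarrow> 'a::complex_inner op \<Rightarrow> bool"
  where "dim_eq_deficiency_number _ A \<longleftrightarrow>
    same_hilbert_dim (UNIV :: 'h set) (defect_subspace A \<i>) \<and>
    same_hilbert_dim (UNIV :: 'h set) (defect_subspace A (- \<i>))"


section \<open>Boundary triplets and Weyl functions\<close>

text \<open>The boundary maps are only relevant on the domain of \<open>A\<^sup>*\<close>.\<close>

definition boundary_triplet ::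
    "'a::chilbert_space op \<Rightarrow> ('a \<Rightarrow> 'h::chilbert_space) \<Rightarrow> ('a \<Rightarrow> 'h) \<Rightarrow> bool"
  where "boundary_triplet A \<Gamma>0 \<Gamma>1 \<longleftrightarrow>
    clinear_on (Domain (adj A)) \<Gamma>0 \<and> clinear_on (Domain (adj A)) \<Gamma>1 \<and>
    (\<forall>f f' g g'. (f, f') \<in> adj A \<longrightarrow> (g, g') \<in> adj A \<longrightarrow>
      cinner f' g - cinner f g' = cinner (\<Gamma>1 f) (\<Gamma>0 g) - cinner (\<Gamma>0 f) (\<Gamma>1 g)) \<and>
    (\<lambda>f. (\<Gamma>1 f, \<Gamma>0 f)) ` Domain (adj A) = UNIV"

text \<open>The extension \<open>A\<^sub>0\<close> is the restriction of \<open>A\<^sup>*\<close> to \<open>ker \<Gamma>\<^sub>0\<close>.\<close>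

definition ext0 :: "'a::chilbert_space op \<Rightarrow> ('a \<Rightarrow> 'h::chilbert_space) \<Rightarrow> 'a op"
  where "ext0 A \<Gamma>0 = restrict_op (adj A) {f \<in> Domain (adj A). \<Gamma>0 f = 0}"

text \<open>Since \<open>\<Gamma>\<^sub>0\<close> maps \<open>\<NN>\<^sub>z\<close> onto the boundary space for \<open>z\<close> in the resolvent set of \<open>A\<^sub>0\<close>, this
  determines \<open>M z\<close> there.  That \<open>M z\<close> is bounded and linear is a consequence, not a requirement.\<close>

definition weyl_function ::
    "'a::chilbert_space op \<Rightarrow> ('a \<Rightarrow> 'h::chilbert_space) \<Rightarrow> ('a \<Rightarrow> 'h) \<Rightarrow> (complex \<Rightarrow> 'h \<Rightarrow> 'h) \<Rightarrow> bool"
  where "weyl_function A \<Gamma>0 \<Gamma>1 M \<longleftrightarrow>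
    (\<forall>z \<in> resolvent_set (ext0 A \<Gamma>0). \<forall>f \<in> defect_subspace A z. M z (\<Gamma>0 f) = \<Gamma>1 f)"


section \<open>Gamma-fields and Q-functions\<close>

definition self_adjoint_extension :: "'a::chilbert_space op \<Rightarrow> 'a op \<Rightarrow> bool"
  where "self_adjoint_extension A T \<longleftrightarrow> self_adjoint T \<and> A \<subseteq> T"

definition gamma_field ::
    "'a::chilbert_space op \<Rightarrow> 'a op \<Rightarrow> (complex \<Rightarrow> 'h::chilbert_space \<Rightarrow> 'a) \<Rightarrow> bool"
  where "gamma_field A T \<gamma> \<longleftrightarrow>
    self_adjoint_extension A T \<and>
    dim_eq_deficiency_number TYPE('h) A \<and>
    (\<exists>z0 \<in> resolvent_set T.
      bounded_op UNIV (defect_subspace A z0) (\<gamma> z0) \<and>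
      (\<exists>\<delta>. bounded_op (defect_subspace A z0) UNIV \<delta> \<and>
        (\<forall>h. \<delta> (\<gamma> z0 h) = h) \<and> (\<forall>f \<in> defect_subspace A z0. \<gamma> z0 (\<delta> f) = f)) \<and>
      (\<forall>z \<in> resolvent_set T. \<forall>h. (\<gamma> z0 h, \<gamma> z h) \<in> (shift T z)\<inverse> O shift T z0))"

definition Q_function ::
    "'a::chilbert_space op \<Rightarrow> 'a op \<Rightarrow> (complex \<Rightarrow> 'h::chilbert_space \<Rightarrow> 'h) \<Rightarrow> bool"
  where "Q_function A T Q \<longleftrightarrow>
    (\<forall>z \<in> resolvent_set T. bounded_op UNIV UNIV (Q z)) \<and>
    (\<exists>\<gamma> :: complex \<Rightarrow> 'h \<Rightarrow> 'a. gamma_field A T \<gamma> \<and>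
      (\<forall>z \<in> resolvent_set T. \<forall>\<zeta> \<in> resolvent_set T. \<forall>h.
        Q z h - bounded_adjoint (Q \<zeta>) h = (z - cnj \<zeta>) *\<^sub>C bounded_adjoint (\<gamma> \<zeta>) (\<gamma> z h)))"

end

theory Submission
  imports Defs
begin

text \<open>
  Green's identity and the surjectivity of \<open>(\<Gamma>\<^sub>1, \<Gamma>\<^sub>0)\<close> show that \<open>A\<^sub>0\<close> is self-adjoint and that \<open>\<Gamma>\<^sub>0\<close>
  maps \<open>\<NN>\<^sub>z\<close> bijectively onto the boundary space for \<open>z \<in> \<rho>(A\<^sub>0)\<close>; the \<open>\<gamma>\<close>-field is
  \<open>\<gamma>(z) = (\<Gamma>\<^sub>0 | \<NN>\<^sub>z)\<inverse>\<close>, and \<open>M(z) = \<Gamma>\<^sub>1 \<gamma>(z)\<close>. Each of \<open>\<gamma>(z)\<close>, \<open>\<Gamma>\<^sub>0 | \<NN>\<^sub>z\<close> and \<open>M(z)\<close> has,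
  again by Green's identity, an everywhere defined formal adjoint and is therefore bounded. The
  \<open>Q\<close>-function identity is Green's identity for \<open>\<gamma>(z) h\<close> and \<open>\<gamma>(\<zeta>) k\<close>. For the dimension of the boundary
  space, \<open>\<gamma>(\<i>)\<close> and \<open>\<gamma>(-\<i>)\<close> are isomorphisms, and separability leaves only the distinction between
  finite and countably infinite orthonormal bases.
\<close>

section \<open>Complex inner product spaces\<close>

interpretation cvec: vector_space "scaleC :: complex \<Rightarrow> 'a::complex_inner \<Rightarrow> 'a"
proof
  fix x :: 'a
  show "1 *\<^sub>C x = x"
    using scaleR_scaleC[of 1 x] by simp
qed (auto simp: scaleC_add_right scaleC_add_left scaleC_scaleC)

lemma cinner_add_right: "cinner x (y + z) = cinner x y + cinner x z"
  by (metis cinner_add_left cinner_commute complex_cnj_add)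

lemma cinner_scaleC_right: "cinner x (a *\<^sub>C y) = cnj a * cinner x y"
  by (metis cinner_commute cinner_scaleC_left complex_cnj_mult)

lemma cinner_zero_left [simp]: "cinner 0 x = 0"
  using cinner_scaleC_left[of 0 0 x] by simp

lemma cinner_zero_right [simp]: "cinner x 0 = 0"
  by (metis cinner_commute cinner_zero_left complex_cnj_zero)

lemma cinner_diff_left: "cinner (x - y) z = cinner x z - cinner y z"
  by (metis cinner_add_left add_diff_cancel_right' diff_add_cancel)

lemma cinner_diff_right: "cinner x (y - z) = cinner x y - cinner x z"
  by (metis cinner_diff_left cinner_commute complex_cnj_diff)

lemma cinner_sum_left: "cinner (\<Sum>i\<in>I. f i) x = (\<Sum>i\<in>I. cinner (f i) x)"
  by (induction I rule: infinite_finite_induct) (auto simp: cinner_add_left)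

lemma cinner_self: "cinner x x = complex_of_real ((norm x)\<^sup>2)"
proof -
  have "Im (cinner x x) = 0"
    using arg_cong[OF cinner_commute[of x x], of Im] by simp
  moreover have "Re (cinner x x) = (norm x)\<^sup>2"
    by (simp add: inner_cinner[symmetric] power2_norm_eq_inner)
  ultimately show ?thesis
    by (simp add: complex_eq_iff)
qed

lemma norm_scaleC: "norm (a *\<^sub>C x) = cmod a * norm x"
proof -
  have "complex_of_real ((norm (a *\<^sub>C x))\<^sup>2) = complex_of_real ((cmod a * norm x)\<^sup>2)"
    unfolding cinner_self[symmetric] cinner_scaleC_left cinner_scaleC_right
    by (simp only: cinner_self power_mult_distrib of_real_mult complex_norm_square ac_simps)
  then have "(norm (a *\<^sub>C x))\<^sup>2 = (cmod a * norm x)\<^sup>2"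
    using of_real_eq_iff by blast
  then show ?thesis
    by (simp add: power2_eq_iff_nonneg)
qed

lemma bounded_linear_scaleC: "bounded_linear ((*\<^sub>C) a)"
proof (rule bounded_linear_intro)
  show "a *\<^sub>C (r *\<^sub>R x) = r *\<^sub>R (a *\<^sub>C x)" for r x
    by (simp add: scaleR_scaleC scaleC_scaleC mult.commute)
  show "norm (a *\<^sub>C x) \<le> norm x * cmod a" for x :: 'a
    by (simp add: norm_scaleC)
qed (rule scaleC_add_right)

lemma cmod_cinner_le: "cmod (cinner x y) \<le> norm x * norm y"
proof (cases "cinner x y = 0")
  case False
  \<comment> \<open>A unimodular factor rotating \<open>cinner x y\<close> onto its modulus, so that
    the real Cauchy-Schwarz inequality applies.\<close>
  define a where "a = cnj (cinner x y) / cmod (cinner x y)"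
  have "a * cinner x y = cmod (cinner x y)"
    using False by (simp add: a_def complex_norm_square[symmetric] mult.commute power2_eq_square)
  then have "cmod (cinner x y) = inner (a *\<^sub>C x) y"
    by (simp add: inner_cinner cinner_scaleC_left)
  also have "\<dots> \<le> norm (a *\<^sub>C x) * norm y"
    by (rule norm_cauchy_schwarz)
  also have "norm (a *\<^sub>C x) = norm x"
    using False by (simp add: norm_scaleC a_def norm_divide)
  finally show ?thesis .
qed simp

lemma cinner_ext_right:
  assumes "\<And>h. cinner h x = cinner h y"
  shows "x = y"
proof -
  have "cinner (x - y) (x - y) = 0"
    using assms by (simp add: cinner_diff_right)
  then show ?thesis
    by (simp add: cinner_self)
qed

text \<open>The vectors orthogonal to \<open>y\<close> in the real sense form a closed set
  containing \<open>D\<close>, hence \<open>y\<close> itself.\<close>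

lemma dense_orthogonal_zero:
  fixes y :: "'a::complex_inner"
  assumes "closure D = UNIV" and "\<And>f. f \<in> D \<Longrightarrow> cinner f y = 0"
  shows "y = 0"
proof -
  have "closed {f. inner f y = 0}"
    by (intro closed_Collect_eq continuous_intros)
  moreover have "D \<subseteq> {f. inner f y = 0}"
    using assms(2) by (auto simp: inner_cinner)
  ultimately have "closure D \<subseteq> {f. inner f y = 0}"
    by (rule closure_minimal[rotated])
  then have "inner y y = 0"
    using assms(1) by blast
  then show ?thesis
    by simp
qed

text \<open>Nondegeneracy of the inner product makes the representing vector unique, so any explicit
  formula for it evaluates the description in \<open>bounded_adjoint\<close>.\<close>

lemma bounded_adjoint_eqI:
  assumes "\<And>h. cinner (T h) y = cinner h x"
  shows "bounded_adjoint T y = x"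
  unfolding bounded_adjoint_def
proof (rule the_equality)
  show "\<forall>h. cinner (T h) y = cinner h x"
    using assms by blast
  show "x' = x" if "\<forall>h. cinner (T h) y = cinner h x'" for x'
    by (rule cinner_ext_right) (metis that assms)
qed

section \<open>Projection theorem and uniform boundedness\<close>

text \<open>A minimising sequence for the distance from a point \<open>x\<close> outside
  \<open>S\<close> converges to a nearest point \<open>p\<close>, and \<open>x - p\<close> is
  orthogonal to \<open>S\<close>.\<close>

lemma closed_subspace_orthogonal:
  fixes S :: "'a::{real_inner, complete_space} set"
  assumes "closed S" "subspace S" "S \<noteq> UNIV"
  obtains y where "y \<noteq> 0" "\<And>s. s \<in> S \<Longrightarrow> inner s y = 0"
proof -
  obtain x where x: "x \<notin> S"
    using assms(3) by blast
  define D where "D = (INF s\<in>S. (norm (x - s))\<^sup>2)"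
  have bdd: "bdd_below ((\<lambda>s. (norm (x - s))\<^sup>2) ` S)"
    by (intro bdd_belowI[of _ 0]) auto
  have D_le: "D \<le> (norm (x - s))\<^sup>2" if "s \<in> S" for s
    unfolding D_def using bdd that by (rule cINF_lower)
  have "S \<noteq> {}"
    using assms(2) subspace_0 by blast
  have "\<exists>s\<in>S. (norm (x - s))\<^sup>2 < D + inverse (real (Suc n))" for n
  proof -
    have "D < D + inverse (real (Suc n))"
      by simp
    then show ?thesis
      unfolding D_def using cINF_less_iff[OF \<open>S \<noteq> {}\<close> bdd] by metis
  qed
  then obtain s where s: "\<And>n. s n \<in> S" "\<And>n. (norm (x - s n))\<^sup>2 < D + inverse (real (Suc n))"
    by metis
  \<comment> \<open>Parallelogram law: the midpoint of \<open>s m\<close> and \<open>s n\<close>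
    lies in \<open>S\<close>, so its squared distance to \<open>x\<close> is at least
    \<open>D\<close>.\<close>
  have close: "(norm (s m - s n))\<^sup>2 \<le> 2 * inverse (real (Suc m)) + 2 * inverse (real (Suc n))" for m n
  proof -
    have "(1/2) *\<^sub>R (s m + s n) \<in> S"
      using assms(2) s(1) by (intro subspace_scale subspace_add)
    from D_le[OF this] have "D \<le> (norm (x - (1/2) *\<^sub>R (s m + s n)))\<^sup>2" .
    moreover have "(norm (s m - s n))\<^sup>2 = 2 * (norm (x - s m))\<^sup>2 + 2 * (norm (x - s n))\<^sup>2
        - 4 * (norm (x - (1/2) *\<^sub>R (s m + s n)))\<^sup>2"
      unfolding power2_norm_eq_inner
      by (simp add: inner_diff_left inner_diff_right inner_add_left inner_add_right
          inner_commute algebra_simps)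
    ultimately show ?thesis
      using s(2)[of m] s(2)[of n] by simp
  qed
  have "Cauchy s"
  proof (rule metric_CauchyI)
    fix e :: real
    assume "e > 0"
    obtain N where N: "inverse (real (Suc N)) < e\<^sup>2 / 4"
      using reals_Archimedean[of "e\<^sup>2 / 4"] \<open>e > 0\<close> by auto
    have "dist (s m) (s n) < e" if "m \<ge> N" "n \<ge> N" for m n
    proof -
      have "inverse (real (Suc m)) \<le> inverse (real (Suc N))"
        "inverse (real (Suc n)) \<le> inverse (real (Suc N))"
        using that by (auto intro!: le_imp_inverse_le)
      then have "(norm (s m - s n))\<^sup>2 < e\<^sup>2"
        using close[of m n] N by linarith
      then show ?thesis
        using \<open>e > 0\<close> by (auto simp: dist_norm intro: power2_less_imp_less)
    qed
    then show "\<exists>M. \<forall>m\<ge>M. \<forall>n\<ge>M. dist (s m) (s n) < e"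
      by blast
  qed
  then obtain p where p: "s \<longlonglongrightarrow> p"
    using Cauchy_convergent convergent_def by blast
  have "p \<in> S"
    using assms(1) s(1) p closed_sequentially by blast
  have "(norm (x - p))\<^sup>2 \<le> D"
  proof (rule tendsto_le)
    show "(\<lambda>n. (norm (x - s n))\<^sup>2) \<longlonglongrightarrow> (norm (x - p))\<^sup>2"
      by (intro tendsto_intros p)
    show "(\<lambda>n. D + inverse (real (Suc n))) \<longlonglongrightarrow> D"
      using tendsto_add[OF tendsto_const LIMSEQ_inverse_real_of_nat, of D] by simp
  qed (use s(2) in \<open>auto intro!: always_eventually less_imp_le\<close>)
  define y where "y = x - p"
  have "inner u y = 0" if "u \<in> S" for u
  proof (cases "u = 0")
    case False
    \<comment> \<open>\<open>t *\<^sub>R u\<close> is the projection of \<open>y\<close> onto the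
      line through \<open>u\<close>; moving \<open>p\<close> by it would bring it closer to
      \<open>x\<close> unless \<open>inner u y = 0\<close>.\<close>
    define t where "t = inner u y / inner u u"
    have "p + t *\<^sub>R u \<in> S"
      using assms(2) \<open>p \<in> S\<close> that by (intro subspace_add subspace_scale)
    from D_le[OF this] have "D \<le> (norm (y - t *\<^sub>R u))\<^sup>2"
      by (simp add: y_def diff_diff_eq)
    then have "(norm y)\<^sup>2 \<le> (norm (y - t *\<^sub>R u))\<^sup>2"
      using \<open>(norm (x - p))\<^sup>2 \<le> D\<close> unfolding y_def by linarith
    moreover have "(norm (y - t *\<^sub>R u))\<^sup>2 = (norm y)\<^sup>2 + (t\<^sup>2 * inner u u - 2 * (t * inner u y))"
      unfolding power2_norm_eq_inner
      by (simp add: inner_diff_left inner_diff_right inner_commute[of y u] power2_eq_square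
          right_diff_distrib)
    ultimately have "0 \<le> t\<^sup>2 * inner u u - 2 * (t * inner u y)"
      by linarith
    moreover have t: "t * inner u u = inner u y"
      using False by (simp add: t_def)
    ultimately have "t * inner u y \<le> 0"
      by (simp add: power2_eq_square mult.assoc)
    then have "t * inner u y * inner u u \<le> 0"
      by (rule mult_nonpos_nonneg) simp
    also have "t * inner u y * inner u u = inner u y * inner u y"
      by (simp add: t[symmetric] ac_simps)
    finally have "(inner u y)\<^sup>2 \<le> 0"
      by (simp only: power2_eq_square)
    then show ?thesis
      by simp
  qed simp
  moreover have "y \<noteq> 0"
    using x \<open>p \<in> S\<close> by (auto simp: y_def)
  ultimately show ?thesis
    using that by blast
qed

text \<open>The Hellinger--Toeplitz principle, via Baire category on the target space; it replaces the
  closed graph theorem below.\<close>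

lemma weakly_bounded_imp_bounded:
  fixes T :: "'a::complex_inner \<Rightarrow> 'b::chilbert_space"
  assumes "\<And>k. \<exists>C. \<forall>x\<in>S. cmod (cinner (T x) k) \<le> C * norm x"
  shows "\<exists>K. \<forall>x\<in>S. norm (T x) \<le> K * norm x"
proof -
  define F where "F n = {k. \<forall>x\<in>S. cmod (cinner (T x) k) \<le> real n * norm x}" for n
  have cont: "continuous_on UNIV (\<lambda>k. cinner u k)" for u :: 'b
  proof -
    have "dist (cinner u k) (cinner u l) \<le> norm u * dist k l" for k l
      using cmod_cinner_le[of u "k - l"] by (simp add: dist_norm cinner_diff_right)
    then have "(norm u)-lipschitz_on UNIV (cinner u)"
      by (intro lipschitz_onI) auto
    then show ?thesis
      using lipschitz_on_continuous_on by blast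
  qed
  have "closed (F n)" for n
  proof -
    have "F n = (\<Inter>x\<in>S. {k. cmod (cinner (T x) k) \<le> real n * norm x})"
      by (auto simp: F_def)
    moreover have "closed {k. cmod (cinner (T x) k) \<le> real n * norm x}" for x
      by (intro closed_Collect_le continuous_intros cont)
    ultimately show ?thesis
      by auto
  qed
  moreover have "\<Union>(range F) = UNIV"
  proof -
    have "\<exists>n. k \<in> F n" for k
    proof -
      obtain C where C: "\<forall>x\<in>S. cmod (cinner (T x) k) \<le> C * norm x"
        using assms by blast
      obtain n where "C \<le> real n"
        using real_arch_simple by blast
      then have "C * norm x \<le> real n * norm x" for x :: 'a
        by (intro mult_right_mono) auto
      then show ?thesis
        using C order_trans unfolding F_def by blast
    qed
    then show ?thesis
      by blast
  qed
  ultimately have "\<exists>n. interior (F n) \<noteq> {}"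
    using Baire_category_alt[of "euclidean :: 'b topology" "range F"]
    by (auto simp: completely_metrizable_space_euclidean closed_closedin[symmetric])
  then obtain n k0 where "k0 \<in> interior (F n)"
    by blast
  then obtain r where r: "r > 0" "ball k0 r \<subseteq> F n"
    using mem_interior by blast
  have "norm (T x) \<le> (4 * real n / r) * norm x" if "x \<in> S" for x
  proof (cases "T x = 0")
    case False
    \<comment> \<open>A multiple of \<open>T x\<close> of norm \<open>r / 2\<close>: both
      \<open>k0\<close> and \<open>k0 + u\<close> lie in the ball, and combining their estimates
      bounds \<open>norm (T x)\<close>.\<close>
    define u where "u = (r / (2 * norm (T x))) *\<^sub>R T x"
    have "norm u < r"
      using False r(1) by (simp add: u_def)
    then have "k0 + u \<in> F n" "k0 \<in> F n"
      using r by (auto simp: dist_norm)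
    then have "cmod (cinner (T x) (k0 + u)) \<le> real n * norm x" "cmod (cinner (T x) k0) \<le> real n * norm x"
      using that by (auto simp: F_def)
    then have "cmod (cinner (T x) u) \<le> 2 * real n * norm x"
      using norm_triangle_ineq4[of "cinner (T x) (k0 + u)" "cinner (T x) k0"]
      by (simp add: cinner_add_right)
    moreover have "cinner (T x) u = complex_of_real (r / 2 * norm (T x))"
      using False by (simp add: u_def scaleR_scaleC cinner_scaleC_right cinner_self power2_eq_square)
    ultimately have "r / 2 * norm (T x) \<le> 2 * real n * norm x"
      using r(1) by (simp only: norm_of_real)
    then show ?thesis
      using r(1) by (simp add: field_simps)
  qed (use r(1) in simp)
  then show ?thesis
    by blast
qed

section \<open>Self-adjoint operators\<close>

lemma in_adj_iff: "(g, g') \<in> adj A \<longleftrightarrow> (\<forall>f f'. (f, f') \<in> A \<longrightarrow> cinner f' g = cinner f g')"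
  by (simp add: adj_def)

lemma linear_operatorD:
  assumes "linear_operator A"
  shows "(f, f') \<in> A \<Longrightarrow> (f, f'') \<in> A \<Longrightarrow> f' = f''"
    and "(f, f') \<in> A \<Longrightarrow> (g, g') \<in> A \<Longrightarrow> (f + g, f' + g') \<in> A"
    and "(f, f') \<in> A \<Longrightarrow> (g, g') \<in> A \<Longrightarrow> (f - g, f' - g') \<in> A"
    and "(f, f') \<in> A \<Longrightarrow> (c *\<^sub>C f, c *\<^sub>C f') \<in> A"
    and "(0, 0) \<in> A"
proof -
  show add: "(f, f') \<in> A \<Longrightarrow> (g, g') \<in> A \<Longrightarrow> (f + g, f' + g') \<in> A" for f f' g g'
    using assms by (simp add: linear_operator_def)
  show scale: "(f, f') \<in> A \<Longrightarrow> (c *\<^sub>C f, c *\<^sub>C f') \<in> A" for c f f'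
    using assms by (simp add: linear_operator_def)
  show "(f, f') \<in> A \<Longrightarrow> (g, g') \<in> A \<Longrightarrow> (f - g, f' - g') \<in> A" for f f' g g'
    using add[of f f' "- g" "- g'"] scale[of g g' "- 1"] by simp
qed (use assms in \<open>auto simp: linear_operator_def single_valued_def\<close>)

text \<open>Density of the domain gives single-valuedness: two images of one vector differ by a
  vector orthogonal to \<open>Domain A\<close>.\<close>

lemma linear_operator_adj:
  assumes "densely_defined A"
  shows "linear_operator (adj A)"
proof -
  have "single_valued (adj A)"
  proof (rule single_valuedI)
    fix g g' g''
    assume "(g, g') \<in> adj A" "(g, g'') \<in> adj A"
    then have "cinner f (g' - g'') = 0" if "f \<in> Domain A" for f
      using that by (auto simp: in_adj_iff cinner_diff_right)
    then have "g' - g'' = 0"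
      using assms dense_orthogonal_zero unfolding densely_defined_def by blast
    then show "g' = g''"
      by simp
  qed
  then show ?thesis
    by (auto simp: linear_operator_def in_adj_iff cinner_add_right cinner_scaleC_right)
qed

lemma closed_adj: "closed (adj A)"
proof -
  have "closed {(g, g'). cinner f' g = cinner f g'}" for f f' :: 'a
  proof -
    \<comment> \<open>Splits the complex equation into its real and imaginary parts, the latter
      reached through the factor \<i>, so that continuity of the real inner product
      suffices.\<close>
    have "{(g, g'). cinner f' g = cinner f g'} =
        {p. inner f' (fst p) = inner f (snd p) \<and> inner (\<i> *\<^sub>C f') (fst p) = inner (\<i> *\<^sub>C f) (snd p)}"
      by (auto simp: inner_cinner complex_eq_iff cinner_scaleC_left)
    also have "closed \<dots>"
      by (intro closed_Collect_conj closed_Collect_eq continuous_intros)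
    finally show ?thesis .
  qed
  moreover have "adj A = (\<Inter>(f, f')\<in>A. {(g, g'). cinner f' g = cinner f g'})"
    by (auto simp: in_adj_iff)
  ultimately show ?thesis
    by auto
qed

text \<open>Since \<open>cinner f' f\<close> is real, \<open>cinner (f' - z *\<^sub>C f) f\<close>
  has imaginary part \<open>- Im z * (norm f)\<^sup>2\<close>; Cauchy-Schwarz bounds it.\<close>

lemma self_adjoint_lower_bound:
  assumes "self_adjoint T" and "(f, f') \<in> T"
  shows "\<bar>Im z\<bar> * norm f \<le> norm (f' - z *\<^sub>C f)"
proof -
  have "cinner f' f = cinner f f'"
    using assms unfolding self_adjoint_def by (metis in_adj_iff)
  then have "Im (cinner f' f) = 0"
    using arg_cong[OF cinner_commute[of f' f], of Im] by simp
  then have "Im (cinner (f' - z *\<^sub>C f) f) = - Im z * (norm f)\<^sup>2"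
    by (simp add: cinner_diff_left cinner_scaleC_left cinner_self)
  then have "\<bar>Im z\<bar> * (norm f)\<^sup>2 \<le> cmod (cinner (f' - z *\<^sub>C f) f)"
    using abs_Im_le_cmod[of "cinner (f' - z *\<^sub>C f) f"] by (simp add: abs_mult)
  also have "\<dots> \<le> norm (f' - z *\<^sub>C f) * norm f"
    by (rule cmod_cinner_le)
  finally have "(\<bar>Im z\<bar> * norm f) * norm f \<le> norm (f' - z *\<^sub>C f) * norm f"
    by (simp add: power2_eq_square)
  then show ?thesis
    by (cases "f = 0") auto
qed

section \<open>Resolvent sets and defect subspaces, with (T - z) f = g rewritten as T f = g + z
  f\<close>

lemma in_shift_iff: "(f, g) \<in> shift T z \<longleftrightarrow> (f, g + z *\<^sub>C f) \<in> T"
  unfolding shift_def by force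

lemma in_defect_subspace_iff: "f \<in> defect_subspace A z \<longleftrightarrow> (f, z *\<^sub>C f) \<in> adj A"
  by (simp add: defect_subspace_def kernel_def in_shift_iff)

text \<open>The estimate at right-hand side zero makes solutions unique; uniqueness makes the
  solution map linear, and the estimate bounds it.\<close>

lemma resolvent_setI:
  assumes T: "linear_operator T"
    and surj: "\<And>g. \<exists>f. (f, g + z *\<^sub>C f) \<in> T"
    and bound: "\<And>f g. (f, g + z *\<^sub>C f) \<in> T \<Longrightarrow> norm f \<le> K * norm g"
  shows "z \<in> resolvent_set T"
proof -
  note lin = linear_operatorD[OF T]
  obtain R where R: "\<And>g. (R g, g + z *\<^sub>C R g) \<in> T"
    using surj by metis
  have unique: "f = R g" if "(f, g + z *\<^sub>C f) \<in> T" for f g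
  proof -
    have "(f - R g, 0 + z *\<^sub>C (f - R g)) \<in> T"
      using lin(3)[OF that R[of g]] by (simp add: cvec.scale_right_diff_distrib)
    from bound[OF this] show ?thesis
      by simp
  qed
  have "R (x + y) = R x + R y" for x y
    using lin(2)[OF R[of x] R[of y]]
    by (intro unique[symmetric]) (simp add: scaleC_add_right algebra_simps)
  moreover have "R (c *\<^sub>C x) = c *\<^sub>C R x" for c x
    using lin(4)[OF R[of x], of c]
    by (intro unique[symmetric]) (simp add: scaleC_add_right scaleC_scaleC mult.commute)
  ultimately have "bounded_op UNIV UNIV R"
    using bound[OF R] by (auto simp: bounded_op_def clinear_on_def)
  moreover have "(shift T z)\<inverse> = {(g, R g) | g. True}"
    using R unique by (auto simp: in_shift_iff)
  ultimately show ?thesis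
    unfolding resolvent_set_def by blast
qed

lemma resolvent_setE:
  assumes "z \<in> resolvent_set T"
  obtains R where "bounded_op UNIV UNIV R" "\<And>f g. (f, g + z *\<^sub>C f) \<in> T \<longleftrightarrow> f = R g"
proof -
  obtain R where R: "bounded_op UNIV UNIV R" "(shift T z)\<inverse> = {(g, R g) | g. True}"
    using assms unfolding resolvent_set_def by blast
  have "(f, g + z *\<^sub>C f) \<in> T \<longleftrightarrow> f = R g" for f g
  proof -
    have "(f, g + z *\<^sub>C f) \<in> T \<longleftrightarrow> (g, f) \<in> (shift T z)\<inverse>"
      by (simp add: in_shift_iff)
    then show ?thesis
      unfolding R(2) by auto
  qed
  then show ?thesis
    using that R(1) by blast
qed

text \<open>The lower bound and closedness of \<open>T\<close> make the range of T - z closed. A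
  vector orthogonal to it lies in the kernel of T - \<open>cnj z\<close>, which is trivial by the
  same bound.\<close>

lemma nonreal_in_resolvent_set:
  fixes T :: "'a::chilbert_space op"
  assumes sa: "self_adjoint T" and z: "Im z \<noteq> 0"
  shows "z \<in> resolvent_set T"
proof -
  have T: "linear_operator T" and adj: "adj T = T"
    using sa by (auto simp: self_adjoint_def)
  note lin = linear_operatorD[OF T]
  \<comment> \<open>Stated for every nonreal \<open>w\<close> because it is used both at
    \<open>z\<close> and at \<open>cnj z\<close>.\<close>
  have bound: "norm f \<le> inverse \<bar>Im w\<bar> * norm g" if "(f, g + w *\<^sub>C f) \<in> T" "Im w \<noteq> 0" for f g w
    using self_adjoint_lower_bound[OF sa that(1), of w] that(2) by (simp add: field_simps)
  define S where "S = {g. \<exists>f. (f, g + z *\<^sub>C f) \<in> T}"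
  have scale: "c *\<^sub>C x \<in> S" if x: "x \<in> S" for c x
  proof -
    obtain f where "(f, x + z *\<^sub>C f) \<in> T"
      using x unfolding S_def by blast
    from lin(4)[OF this, of c] have "(c *\<^sub>C f, c *\<^sub>C x + z *\<^sub>C (c *\<^sub>C f)) \<in> T"
      by (simp add: scaleC_add_right scaleC_scaleC mult.commute)
    then show ?thesis
      unfolding S_def by blast
  qed
  have "subspace S"
  proof (rule subspaceI)
    show "0 \<in> S"
      using lin(5) by (auto simp: S_def intro!: exI[of _ 0])
    show "x + y \<in> S" if xy: "x \<in> S" "y \<in> S" for x y
    proof -
      obtain f g where "(f, x + z *\<^sub>C f) \<in> T" "(g, y + z *\<^sub>C g) \<in> T"
        using xy by (auto simp: S_def)
      from lin(2)[OF this] have "(f + g, (x + y) + z *\<^sub>C (f + g)) \<in> T"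
        by (simp add: scaleC_add_right algebra_simps)
      then show ?thesis
        by (auto simp: S_def)
    qed
  qed (simp add: scaleR_scaleC scale)
  have "closed S"
    unfolding closed_sequential_limits
  proof (intro allI impI, elim conjE)
    fix g l
    assume "\<forall>n. g n \<in> S" and g: "g \<longlonglongrightarrow> l"
    then have "\<forall>n. \<exists>x. (x, g n + z *\<^sub>C x) \<in> T"
      by (simp add: S_def)
    then obtain f where f: "\<And>n. (f n, g n + z *\<^sub>C f n) \<in> T"
      by (auto dest!: choice)
    have le: "dist (f m) (f n) \<le> inverse \<bar>Im z\<bar> * dist (g m) (g n)" for m n
    proof -
      have "(f m - f n, (g m - g n) + z *\<^sub>C (f m - f n)) \<in> T"
        using lin(3)[OF f[of m] f[of n]] by (simp add: cvec.scale_right_diff_distrib algebra_simps)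
      then show ?thesis
        unfolding dist_norm using z by (rule bound)
    qed
    have "Cauchy g"
      using g LIMSEQ_imp_Cauchy by blast
    have "Cauchy f"
    proof (rule metric_CauchyI)
      fix e :: real
      assume "e > 0"
      then have "e * \<bar>Im z\<bar> > 0"
        using z by simp
      then obtain N where N: "\<And>m n. m \<ge> N \<Longrightarrow> n \<ge> N \<Longrightarrow> dist (g m) (g n) < e * \<bar>Im z\<bar>"
        using \<open>Cauchy g\<close> metric_CauchyD by blast
      have "dist (f m) (f n) < e" if "m \<ge> N" "n \<ge> N" for m n
      proof -
        have "\<bar>Im z\<bar> * dist (f m) (f n) \<le> dist (g m) (g n)"
          using le[of m n] z by (simp add: field_simps)
        also have "\<dots> < \<bar>Im z\<bar> * e"
          using N[OF that] by (simp add: mult.commute)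
        finally show ?thesis
          by (simp add: z)
      qed
      then show "\<exists>M. \<forall>m\<ge>M. \<forall>n\<ge>M. dist (f m) (f n) < e"
        by blast
    qed
    then obtain p where p: "f \<longlonglongrightarrow> p"
      using Cauchy_convergent convergent_def by blast
    then have "(\<lambda>n. z *\<^sub>C f n) \<longlonglongrightarrow> z *\<^sub>C p"
      by (rule bounded_linear.tendsto[OF bounded_linear_scaleC])
    with p g have "(\<lambda>n. (f n, g n + z *\<^sub>C f n)) \<longlonglongrightarrow> (p, l + z *\<^sub>C p)"
      by (intro tendsto_Pair tendsto_add)
    moreover have "closed T"
      using closed_adj[of T] adj by simp
    ultimately have "(p, l + z *\<^sub>C p) \<in> T"
      using closed_sequentially[of T "\<lambda>n. (f n, g n + z *\<^sub>C f n)"] f by simp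
    then show "l \<in> S"
      unfolding S_def by blast
  qed
  have "S = UNIV"
  proof (rule ccontr)
    assume "S \<noteq> UNIV"
    then obtain y where y: "y \<noteq> 0" "\<And>s. s \<in> S \<Longrightarrow> inner s y = 0"
      using closed_subspace_orthogonal[OF \<open>closed S\<close> \<open>subspace S\<close>] by blast
    \<comment> \<open>\<open>S\<close> is a complex subspace, so real orthogonality to
      \<open>\<i> *\<^sub>C s\<close> also removes the imaginary part.\<close>
    have orth: "cinner s y = 0" if "s \<in> S" for s
      using y(2)[OF that] y(2)[OF scale[OF that, of \<i>]]
      by (simp add: inner_cinner cinner_scaleC_left complex_eq_iff)
    have "cinner f' y = cinner f (cnj z *\<^sub>C y)" if "(f, f') \<in> T" for f f'
    proof -
      have "f' - z *\<^sub>C f \<in> S"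
        using that by (auto simp: S_def intro!: exI[of _ f])
      then show ?thesis
        using orth by (force simp: cinner_diff_left cinner_scaleC_left cinner_scaleC_right)
    qed
    then have "(y, 0 + cnj z *\<^sub>C y) \<in> T"
      using adj in_adj_iff[of y "cnj z *\<^sub>C y" T] by auto
    from bound[OF this] z y(1) show False
      by simp
  qed
  then have "\<exists>f. (f, g + z *\<^sub>C f) \<in> T" for g
    by (auto simp: S_def)
  then show ?thesis
    using T bound z by (intro resolvent_setI) auto
qed

text \<open>A real point is its own conjugate, and nonreal points all belong to the resolvent
  set.\<close>

lemma cnj_in_resolvent_set:
  fixes T :: "'a::chilbert_space op"
  assumes "self_adjoint T" and "z \<in> resolvent_set T"
  shows "cnj z \<in> resolvent_set T"
proof (cases "Im z = 0")
  case True
  then have "cnj z = z"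
    by (simp add: complex_eq_iff)
  then show ?thesis
    using assms(2) by simp
next
  case False
  then show ?thesis
    by (intro nonreal_in_resolvent_set assms(1)) simp
qed

section \<open>Hilbert space dimension\<close>

text \<open>Choosing a point of \<open>D\<close> within \<open>e / 2\<close> of each element is
  injective on \<open>X\<close>: two elements with a common choice would be closer than
  \<open>e\<close>.\<close>

lemma separated_imp_countable:
  fixes D X :: "'a::metric_space set"
  assumes D: "countable D" "closure D = UNIV"
    and e: "e > 0" "\<And>x y. x \<in> X \<Longrightarrow> y \<in> X \<Longrightarrow> x \<noteq> y \<Longrightarrow> e \<le> dist x y"
  shows "countable X"
proof -
  have "\<exists>d\<in>D. dist d x < e / 2" for x
    using D(2) e(1) closure_approachable[of x D] by (metis UNIV_I half_gt_zero)
  then obtain d where d: "\<And>x. d x \<in> D" "\<And>x. dist (d x) x < e / 2"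
    by metis
  have "inj_on d X"
  proof (rule inj_onI, rule ccontr)
    fix x y
    assume "x \<in> X" "y \<in> X" "d x = d y" "x \<noteq> y"
    then have "dist x y < e"
      using d(2)[of x] d(2)[of y] dist_triangle_half_r[of "d x" x e y] by simp
    then show False
      using e(2) \<open>x \<in> X\<close> \<open>y \<in> X\<close> \<open>x \<noteq> y\<close> by force
  qed
  moreover have "countable (d ` X)"
    using D(1) d(1) by (meson countable_subset image_subsetI)
  ultimately show ?thesis
    using countable_image_inj_on by blast
qed

text \<open>Separated from \<open>orthonormal_basis\<close> to cover sets that need not be
  maximal.\<close>

definition orthonormal :: "'a::complex_inner set \<Rightarrow> bool"
  where "orthonormal B \<longleftrightarrow> (\<forall>b\<in>B. \<forall>c\<in>B. cinner b c = (if b = c then 1 else 0))"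

lemma orthonormal_basis_iff:
  "orthonormal_basis S B \<longleftrightarrow>
    B \<subseteq> S \<and> orthonormal B \<and> (\<forall>x\<in>S. (\<forall>b\<in>B. cinner x b = 0) \<longrightarrow> x = 0)"
  by (simp add: orthonormal_basis_def orthonormal_def)

text \<open>The squared distance is 2; the weaker bound 1 is a convenient separation
  constant.\<close>

lemma orthonormal_dist:
  assumes "orthonormal B" "b \<in> B" "c \<in> B" "b \<noteq> c"
  shows "1 \<le> norm (b - c)"
proof -
  have "complex_of_real ((norm (b - c))\<^sup>2) = 2"
    using assms unfolding cinner_self[symmetric] orthonormal_def
    by (simp add: cinner_diff_left cinner_diff_right)
  then have "(norm (b - c))\<^sup>2 = 2"
    by (metis of_real_eq_iff of_real_numeral)
  then have "1\<^sup>2 \<le> (norm (b - c))\<^sup>2"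
    by simp
  then show ?thesis
    by (rule power2_le_imp_le) simp
qed

text \<open>Pairing a vanishing linear combination with one of its vectors isolates that vector's
  coefficient.\<close>

lemma orthonormal_independent:
  assumes "orthonormal B"
  shows "cvec.independent B"
  unfolding cvec.independent_explicit_finite_subsets
proof (intro allI impI ballI)
  fix F u v
  assume F: "F \<subseteq> B" "finite F" and sum: "(\<Sum>v\<in>F. u v *\<^sub>C v) = 0" and v: "v \<in> F"
  have "0 = cinner (\<Sum>w\<in>F. u w *\<^sub>C w) v"
    by (simp add: sum)
  also have "\<dots> = (\<Sum>w\<in>F. if w = v then u w else 0)"
    unfolding cinner_sum_left cinner_scaleC_left
    using assms F(1) v by (intro sum.cong) (auto simp: orthonormal_def subset_iff)
  also have "\<dots> = u v"
    using F(2) v by simp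
  finally show "u v = 0"
    by simp
qed

text \<open>Zorn's lemma gives a maximal orthonormal subset; a nonzero vector of \<open>S\<close>
  orthogonal to it could be normalised and added.\<close>

lemma orthonormal_basis_exists:
  fixes S :: "'a::complex_inner set"
  assumes "cvec.subspace S"
  obtains B where "orthonormal_basis S B"
proof -
  define \<A> where "\<A> = {B. B \<subseteq> S \<and> orthonormal B}"
  have "\<exists>M\<in>\<A>. \<forall>X\<in>\<A>. M \<subseteq> X \<longrightarrow> X = M"
  proof (rule subset_Zorn')
    fix C
    assume C: "subset.chain \<A> C"
    have "orthonormal (\<Union>C)"
      unfolding orthonormal_def
    proof (intro ballI)
      fix b c
      assume "b \<in> \<Union>C" "c \<in> \<Union>C"
      then obtain X Y where XY: "X \<in> C" "b \<in> X" "Y \<in> C" "c \<in> Y"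
        by blast
      then have "X \<subseteq> Y \<or> Y \<subseteq> X"
        using C by (auto simp: subset_chain_def)
      then obtain Z where "Z \<in> C" "b \<in> Z" "c \<in> Z"
        using XY by blast
      then show "cinner b c = (if b = c then 1 else 0)"
        using C by (auto simp: \<A>_def subset_chain_def orthonormal_def)
    qed
    then show "\<Union>C \<in> \<A>"
      using C by (auto simp: \<A>_def subset_chain_def)
  qed
  then obtain B where "B \<in> \<A>" and max: "\<And>X. X \<in> \<A> \<Longrightarrow> B \<subseteq> X \<Longrightarrow> X = B"
    by blast
  then have B: "B \<subseteq> S" "orthonormal B"
    by (auto simp: \<A>_def)
  have "x = 0" if x: "x \<in> S" "\<forall>b\<in>B. cinner x b = 0" for x
  proof (rule ccontr)
    assume "x \<noteq> 0"
    define e where "e = complex_of_real (inverse (norm x)) *\<^sub>C x"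
    have "cinner e e = 1"
      using \<open>x \<noteq> 0\<close> by (simp add: cinner_self e_def norm_scaleC norm_inverse)
    have orth: "cinner e b = 0 \<and> cinner b e = 0" if "b \<in> B" for b
      using x(2) that cinner_commute[of b x]
      by (simp add: e_def cinner_scaleC_left cinner_scaleC_right)
    have "e \<in> S"
      unfolding e_def using assms x(1) by (rule cvec.subspace_scale)
    have "orthonormal (insert e B)"
      using B(2) orth \<open>cinner e e = 1\<close> unfolding orthonormal_def by auto
    then have "insert e B \<in> \<A>"
      using B(1) \<open>e \<in> S\<close> by (simp add: \<A>_def)
    then have "insert e B = B"
      using max by blast
    then have "cinner e e = 0"
      using orth by blast
    then show False
      using \<open>cinner e e = 1\<close> by simp
  qed
  then show ?thesis
    using that B unfolding orthonormal_basis_iff by blast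
qed

lemma orthonormal_card_le:
  assumes S: "cvec.subspace S" and \<phi>: "clinear_on S \<phi>"
    and B: "orthonormal_basis S B" "finite B" and C: "orthonormal C" "C \<subseteq> \<phi> ` S"
  shows "finite C \<and> card C \<le> card B"
proof -
  have BS: "B \<subseteq> S" and onb: "orthonormal B" and total: "\<And>x. x \<in> S \<Longrightarrow> (\<forall>b\<in>B. cinner x b = 0) \<Longrightarrow> x = 0"
    using B(1) by (auto simp: orthonormal_basis_iff)
  have \<phi>_sum: "(\<Sum>b\<in>F. u b *\<^sub>C b) \<in> S \<and> \<phi> (\<Sum>b\<in>F. u b *\<^sub>C b) = (\<Sum>b\<in>F. u b *\<^sub>C \<phi> b)"
    if "finite F" "F \<subseteq> B" for F u
    using that
  proof (induction F)
    case empty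
    have "0 \<in> S"
      using S by (rule cvec.subspace_0)
    then have "\<phi> (0 *\<^sub>C 0) = 0 *\<^sub>C \<phi> 0"
      using \<phi> unfolding clinear_on_def by blast
    then show ?case
      using \<open>0 \<in> S\<close> by simp
  next
    case (insert b F)
    then have "b \<in> S" "u b *\<^sub>C b \<in> S"
      using BS S cvec.subspace_scale by blast+
    then show ?case
      using insert S \<phi> by (auto simp: clinear_on_def intro: cvec.subspace_add)
  qed
  have "\<phi> x \<in> cvec.span (\<phi> ` B)" if x: "x \<in> S" for x
  proof -
    \<comment> \<open>The Fourier sum of \<open>x\<close>; the difference \<open>x - y\<close> is
      orthogonal to \<open>B\<close>, hence zero.\<close>
    define y where "y = (\<Sum>b\<in>B. cinner x b *\<^sub>C b)"
    have "cinner y c = cinner x c" if "c \<in> B" for c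
    proof -
      have "cinner y c = (\<Sum>b\<in>B. if b = c then cinner x b else 0)"
        unfolding y_def cinner_sum_left cinner_scaleC_left
        using onb that by (intro sum.cong) (auto simp: orthonormal_def)
      then show ?thesis
        using B(2) that by simp
    qed
    moreover have "y \<in> S"
      using \<phi>_sum[OF B(2) order_refl] by (simp add: y_def)
    ultimately have "x - y = 0"
      using total[of "x - y"] S x by (simp add: cinner_diff_left cvec.subspace_diff)
    then have "\<phi> x = \<phi> y"
      by simp
    also have "\<phi> y = (\<Sum>b\<in>B. cinner x b *\<^sub>C \<phi> b)"
      using \<phi>_sum[OF B(2) order_refl] unfolding y_def by blast
    finally have "\<phi> x = (\<Sum>b\<in>B. cinner x b *\<^sub>C \<phi> b)" .
    then show ?thesis
      by (simp only:) (intro cvec.span_sum cvec.span_scale cvec.span_base imageI)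
  qed
  then have "C \<subseteq> cvec.span (\<phi> ` B)"
    using C(2) by blast
  then have "finite C \<and> card C \<le> card (\<phi> ` B)"
    using B(2) C(1) by (intro cvec.independent_span_bound orthonormal_independent) auto
  then show ?thesis
    using card_image_le[OF B(2), of \<phi>] by linarith
qed

lemma same_hilbert_dim_isomorphism:
  fixes \<gamma> :: "'h::complex_inner \<Rightarrow> 'a::chilbert_space"
  assumes sep: "separable_hilbert TYPE('a)"
    and \<gamma>: "clinear_on UNIV \<gamma>" "range \<gamma> = N" and \<delta>: "clinear_on N \<delta>" "\<And>h. \<delta> (\<gamma> h) = h"
    and N: "cvec.subspace N" and bound: "\<And>f. f \<in> N \<Longrightarrow> norm (\<delta> f) \<le> K * norm f"
  shows "same_hilbert_dim (UNIV :: 'h set) N"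
proof -
  obtain D :: "'a set" where D: "countable D" "closure D = UNIV"
    using sep by (auto simp: separable_hilbert_def)
  obtain B :: "'h set" where B: "orthonormal_basis UNIV B"
    using orthonormal_basis_exists cvec.subspace_UNIV by blast
  obtain C where C: "orthonormal_basis N C"
    using orthonormal_basis_exists[OF N] by blast
  have onB: "orthonormal B" and onC: "orthonormal C" "C \<subseteq> N"
    using B C by (auto simp: orthonormal_basis_iff)
  have "countable C"
    using orthonormal_dist[OF onC(1)] by (intro separated_imp_countable[OF D, of 1]) (auto simp: dist_norm)
  have "countable (\<gamma> ` B)"
  proof (rule separated_imp_countable[OF D])
    fix x y
    assume "x \<in> \<gamma> ` B" "y \<in> \<gamma> ` B" "x \<noteq> y"
    then obtain b c where bc: "b \<in> B" "c \<in> B" "b \<noteq> c" "x = \<gamma> b" "y = \<gamma> c"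
      by blast
    have "\<gamma> b = \<gamma> (b - c) + \<gamma> c"
      using \<gamma>(1) unfolding clinear_on_def by (metis UNIV_I diff_add_cancel)
    then have "\<gamma> (b - c) = x - y"
      using bc by simp
    have "1 \<le> norm (b - c)"
      using orthonormal_dist[OF onB] bc by blast
    also have "\<dots> \<le> K * norm (\<gamma> (b - c))"
      using bound[of "\<gamma> (b - c)"] \<gamma>(2) \<delta>(2) by auto
    \<comment> \<open>\<open>\<bar>K\<bar> + 1\<close> is positive whatever the sign of
      \<open>K\<close>, so its reciprocal can serve as separation constant.\<close>
    also have "\<dots> \<le> (\<bar>K\<bar> + 1) * dist x y"
      unfolding \<open>\<gamma> (b - c) = x - y\<close> dist_norm by (intro mult_right_mono) auto
    finally show "inverse (\<bar>K\<bar> + 1) \<le> dist x y"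
      by (simp add: field_simps)
  qed simp
  moreover have "inj_on \<gamma> B"
    using \<delta>(2) by (metis inj_onI)
  ultimately have "countable B"
    using countable_image_inj_on by blast
  have CB: "finite C \<and> card C \<le> card B" if "finite B"
    using orthonormal_card_le[OF cvec.subspace_UNIV \<gamma>(1) B that onC(1)] onC(2) \<gamma>(2) by blast
  have "B \<subseteq> \<delta> ` N"
    using \<gamma>(2) \<delta>(2) by (metis image_eqI rangeI subsetI)
  then have BC: "finite B \<and> card B \<le> card C" if "finite C"
    using orthonormal_card_le[OF N \<delta>(1) C that onB] by blast
  have "B \<approx> C"
  proof (cases "finite B")
    case True
    then have "finite C" "card B = card C"
      using CB BC by (auto intro: antisym)
    then show ?thesis
      using True finite_same_card_bij unfolding eqpoll_def by blast
  next
    case False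
    then have "infinite C"
      using BC by blast
    then show ?thesis
      using False \<open>countable B\<close> \<open>countable C\<close>
      by (metis bij_betw_inv_into bij_betw_trans eqpoll_def to_nat_on_infinite)
  qed
  then show ?thesis
    using B C unfolding same_hilbert_dim_def by blast
qed

section \<open>Boundary triplets\<close>

locale boundary_triplet_operator =
  fixes A :: "'a::chilbert_space op" and \<Gamma>0 \<Gamma>1 :: "'a \<Rightarrow> 'h::chilbert_space"
  assumes dense: "densely_defined A" and symmetric: "symmetric_operator A"
    and triplet: "boundary_triplet A \<Gamma>0 \<Gamma>1"
begin

abbreviation "A0 \<equiv> ext0 A \<Gamma>0"

abbreviation "\<NN> \<equiv> defect_subspace A"

lemmas adj_lin = linear_operatorD[OF linear_operator_adj[OF dense]]

lemma green:
  assumes "(f, f') \<in> adj A" "(g, g') \<in> adj A"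
  shows "cinner f' g - cinner f g' = cinner (\<Gamma>1 f) (\<Gamma>0 g) - cinner (\<Gamma>0 f) (\<Gamma>1 g)"
  using triplet assms unfolding boundary_triplet_def by blast

lemma boundary_values:
  obtains f f' where "(f, f') \<in> adj A" "\<Gamma>0 f = h" "\<Gamma>1 f = k"
proof -
  have "(k, h) \<in> (\<lambda>f. (\<Gamma>1 f, \<Gamma>0 f)) ` Domain (adj A)"
    using triplet unfolding boundary_triplet_def by blast
  then show ?thesis
    using that by auto
qed

lemma \<Gamma>_linear:
  assumes "(f, f') \<in> adj A" "(g, g') \<in> adj A"
  shows "\<Gamma>0 (f + g) = \<Gamma>0 f + \<Gamma>0 g" "\<Gamma>1 (f + g) = \<Gamma>1 f + \<Gamma>1 g"
    "\<Gamma>0 (c *\<^sub>C f) = c *\<^sub>C \<Gamma>0 f" "\<Gamma>1 (c *\<^sub>C f) = c *\<^sub>C \<Gamma>1 f"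
    "\<Gamma>0 (f - g) = \<Gamma>0 f - \<Gamma>0 g"
proof -
  have lin: "clinear_on (Domain (adj A)) \<Gamma>0" "clinear_on (Domain (adj A)) \<Gamma>1"
    using triplet by (auto simp: boundary_triplet_def)
  have D: "f \<in> Domain (adj A)" "g \<in> Domain (adj A)" "f - g \<in> Domain (adj A)"
    using assms adj_lin(3) by blast+
  show "\<Gamma>0 (f + g) = \<Gamma>0 f + \<Gamma>0 g" "\<Gamma>1 (f + g) = \<Gamma>1 f + \<Gamma>1 g"
    "\<Gamma>0 (c *\<^sub>C f) = c *\<^sub>C \<Gamma>0 f" "\<Gamma>1 (c *\<^sub>C f) = c *\<^sub>C \<Gamma>1 f"
    using lin D unfolding clinear_on_def by blast+
  have "\<Gamma>0 ((f - g) + g) = \<Gamma>0 (f - g) + \<Gamma>0 g"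
    using lin D unfolding clinear_on_def by blast
  then show "\<Gamma>0 (f - g) = \<Gamma>0 f - \<Gamma>0 g"
    by (simp add: algebra_simps)
qed

section \<open>The extension \<open>A0\<close> and its self-adjointness\<close>

lemma in_ext0_iff: "(f, f') \<in> A0 \<longleftrightarrow> (f, f') \<in> adj A \<and> \<Gamma>0 f = 0"
  by (auto simp: ext0_def restrict_op_def)

text \<open>Green's identity is tested against \<open>g\<close> in the kernel of
  \<open>\<Gamma>0\<close> with \<open>\<Gamma>1 g = \<Gamma>0 f\<close>. For \<open>f\<close> in
  the domain of \<open>A\<close> the left side vanishes, leaving the squared norm of
  \<open>\<Gamma>0 f\<close>.\<close>

lemma subset_ext0: "A \<subseteq> A0"
proof (rule subrelI)
  fix f f'
  assume f: "(f, f') \<in> A"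
  then have f_adj: "(f, f') \<in> adj A"
    using symmetric unfolding symmetric_operator_def in_adj_iff by metis
  obtain g g' where g: "(g, g') \<in> adj A" "\<Gamma>0 g = 0" "\<Gamma>1 g = \<Gamma>0 f"
    by (rule boundary_values)
  have "cinner f' g = cinner f g'"
    using f g(1) by (simp add: in_adj_iff)
  then have "cinner (\<Gamma>0 f) (\<Gamma>0 f) = 0"
    using green[OF f_adj g(1)] g by simp
  then show "(f, f') \<in> A0"
    using f_adj by (simp add: in_ext0_iff cinner_self)
qed

text \<open>Symmetry holds because each boundary term in Green's identity contains a value of
  \<open>\<Gamma>0\<close>. Conversely, \<open>A \<subseteq> A0\<close> places \<open>adj A0\<close>
  inside \<open>adj A\<close>, and it remains to see that \<open>\<Gamma>0\<close> vanishes on its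
  domain.\<close>

lemma self_adjoint_ext0: "self_adjoint A0"
proof -
  have "single_valued A0"
    using adj_lin(1) by (auto simp: single_valued_def in_ext0_iff)
  moreover have "(0, 0) \<in> A0"
    using adj_lin(5) \<Gamma>_linear(5)[OF adj_lin(5) adj_lin(5)] by (simp add: in_ext0_iff)
  ultimately have "linear_operator A0"
    using adj_lin(2,4) \<Gamma>_linear by (auto simp: linear_operator_def in_ext0_iff)
  moreover have "densely_defined A0"
    using dense closure_mono[OF Domain_mono[OF subset_ext0]] by (auto simp: densely_defined_def)
  moreover have "A0 \<subseteq> adj A0"
    using green by (fastforce simp: in_ext0_iff in_adj_iff[of _ _ A0])
  moreover have "adj A0 \<subseteq> A0"
  proof (rule subrelI)
    fix g g'
    assume g: "(g, g') \<in> adj A0"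
    then have g_adj: "(g, g') \<in> adj A"
      using subset_ext0 by (auto simp: in_adj_iff)
    \<comment> \<open>An element of \<open>A0\<close> whose only boundary term in Green's identity
      is the squared norm of \<open>\<Gamma>0 g\<close>.\<close>
    obtain f f' where f: "(f, f') \<in> adj A" "\<Gamma>0 f = 0" "\<Gamma>1 f = \<Gamma>0 g"
      by (rule boundary_values)
    have "cinner f' g = cinner f g'"
      using g f by (simp add: in_adj_iff[of _ _ A0] in_ext0_iff)
    then have "cinner (\<Gamma>0 g) (\<Gamma>0 g) = 0"
      using green[OF f(1) g_adj] f by simp
    then show "(g, g') \<in> A0"
      using g_adj by (simp add: in_ext0_iff cinner_self)
  qed
  ultimately show ?thesis
    by (auto simp: self_adjoint_def)
qed

section \<open>Boundary values on the defect subspaces\<close>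

lemma subspace_defect: "cvec.subspace (\<NN> z)"
proof (rule cvec.subspaceI)
  show "0 \<in> \<NN> z"
    using adj_lin(5) by (simp add: in_defect_subspace_iff)
  show "x + y \<in> \<NN> z" if "x \<in> \<NN> z" "y \<in> \<NN> z" for x y
    using adj_lin(2) that by (simp add: in_defect_subspace_iff scaleC_add_right)
  show "c *\<^sub>C x \<in> \<NN> z" if "x \<in> \<NN> z" for c x
    using adj_lin(4)[of x "z *\<^sub>C x" c] that
    by (simp add: in_defect_subspace_iff scaleC_scaleC mult.commute)
qed

text \<open>The difference has boundary value zero, so it lies in the kernel of A0 - z, which is
  trivial at a resolvent point.\<close>

lemma defect_unique:
  assumes z: "z \<in> resolvent_set A0" and fg: "f \<in> \<NN> z" "g \<in> \<NN> z" "\<Gamma>0 f = \<Gamma>0 g"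
  shows "f = g"
proof -
  obtain R where R: "bounded_op UNIV UNIV R" "\<And>f g. (f, g + z *\<^sub>C f) \<in> A0 \<longleftrightarrow> f = R g"
    using z by (rule resolvent_setE) blast
  have "f - g \<in> \<NN> z"
    using fg subspace_defect cvec.subspace_diff by blast
  moreover have "\<Gamma>0 (f - g) = 0"
    using fg \<Gamma>_linear(5) by (auto simp: in_defect_subspace_iff)
  ultimately have "(f - g, 0 + z *\<^sub>C (f - g)) \<in> A0"
    by (simp add: in_ext0_iff in_defect_subspace_iff)
  moreover have "(0, 0 + z *\<^sub>C 0) \<in> A0"
    using self_adjoint_ext0 linear_operatorD(5)[of A0] by (simp add: self_adjoint_def)
  ultimately show ?thesis
    using R(2) by (metis eq_iff_diff_eq_0)
qed

text \<open>Any \<open>f\<close> with the right boundary value is corrected by the solution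
  \<open>u\<close> of (A0 - z) u = (A* - z) f: this moves it into the defect subspace and leaves
  \<open>\<Gamma>0\<close> unchanged.\<close>

lemma defect_surj:
  assumes z: "z \<in> resolvent_set A0"
  shows "\<exists>f\<in>\<NN> z. \<Gamma>0 f = h"
proof -
  obtain R where R: "bounded_op UNIV UNIV R" "\<And>f g. (f, g + z *\<^sub>C f) \<in> A0 \<longleftrightarrow> f = R g"
    using z by (rule resolvent_setE) blast
  \<comment> \<open>The value 0 for \<open>\<Gamma>1 f\<close> is an arbitrary choice.\<close>
  obtain f f' where f: "(f, f') \<in> adj A" "\<Gamma>0 f = h" "\<Gamma>1 f = 0"
    by (rule boundary_values)
  define u where "u = R (f' - z *\<^sub>C f)"
  have "(u, f' - z *\<^sub>C f + z *\<^sub>C u) \<in> A0"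
    using R(2) by (simp add: u_def)
  then have u: "(u, f' - z *\<^sub>C f + z *\<^sub>C u) \<in> adj A" "\<Gamma>0 u = 0"
    by (auto simp: in_ext0_iff)
  have "f - u \<in> \<NN> z"
    using adj_lin(3)[OF f(1) u(1)]
    by (simp add: in_defect_subspace_iff cvec.scale_right_diff_distrib)
  moreover have "\<Gamma>0 (f - u) = h"
    using \<Gamma>_linear(5)[OF f(1) u(1)] f u by simp
  ultimately show ?thesis
    by blast
qed

text \<open>The inverse of \<open>\<Gamma>0\<close> on the defect subspace; at points of the
  resolvent set of \<open>A0\<close> the choice is unique.\<close>

definition gamma :: "complex \<Rightarrow> 'h \<Rightarrow> 'a"
  where "gamma z h = (SOME f. f \<in> \<NN> z \<and> \<Gamma>0 f = h)"

section \<open>Linearity and boundedness of the gamma-field at a fixed resolvent point\<close>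

context
  fixes z
  assumes z: "z \<in> resolvent_set A0"
begin

lemma gamma_in: "gamma z h \<in> \<NN> z" and \<Gamma>0_gamma: "\<Gamma>0 (gamma z h) = h"
proof -
  have "\<exists>f. f \<in> \<NN> z \<and> \<Gamma>0 f = h"
    using defect_surj[OF z] by blast
  from someI_ex[OF this] show "gamma z h \<in> \<NN> z" "\<Gamma>0 (gamma z h) = h"
    unfolding gamma_def by blast+
qed

lemma gamma_adj: "(gamma z h, z *\<^sub>C gamma z h) \<in> adj A"
  using gamma_in in_defect_subspace_iff by blast

lemma gamma_eqI: "f \<in> \<NN> z \<Longrightarrow> \<Gamma>0 f = h \<Longrightarrow> gamma z h = f"
  using defect_unique[OF z gamma_in, of f h] \<Gamma>0_gamma by simp

lemma clinear_gamma: "clinear_on UNIV (gamma z)"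
proof -
  have "gamma z (h + k) = gamma z h + gamma z k" for h k
    using cvec.subspace_add[OF subspace_defect gamma_in gamma_in] \<Gamma>_linear(1)[OF gamma_adj gamma_adj] \<Gamma>0_gamma
    by (intro gamma_eqI) auto
  moreover have "gamma z (c *\<^sub>C h) = c *\<^sub>C gamma z h" for c h
    using cvec.subspace_scale[OF subspace_defect gamma_in] \<Gamma>_linear(3)[OF gamma_adj gamma_adj] \<Gamma>0_gamma
    by (intro gamma_eqI) auto
  ultimately show ?thesis
    by (simp add: clinear_on_def)
qed

lemma range_gamma: "range (gamma z) = \<NN> z"
  using gamma_in gamma_eqI by (metis image_subset_iff rangeI subsetI subset_antisym)

text \<open>The formal adjoint of \<^term>\<open>gamma z\<close> is \<open>\<Gamma>\<^sub>1 (A\<^sub>0 - cnj z)\<inverse>\<close>.\<close>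

lemma bounded_gamma: "bounded_op UNIV (\<NN> z) (gamma z)"
proof -
  have "cnj z \<in> resolvent_set A0"
    by (rule cnj_in_resolvent_set[OF self_adjoint_ext0 z])
  then obtain R where R: "\<And>f g. (f, g + cnj z *\<^sub>C f) \<in> A0 \<longleftrightarrow> f = R g"
    by (rule resolvent_setE) blast
  have "cinner (gamma z h) g = cinner h (\<Gamma>1 (R g))" for h g
  proof -
    have f: "(R g, g + cnj z *\<^sub>C R g) \<in> adj A" "\<Gamma>0 (R g) = 0"
      using R[of "R g" g] by (auto simp: in_ext0_iff)
    show ?thesis
      using green[OF gamma_adj[of h] f(1)] f(2)
      by (simp add: \<Gamma>0_gamma cinner_add_right cinner_scaleC_left cinner_scaleC_right)
  qed
  then have "\<exists>C. \<forall>h\<in>UNIV. cmod (cinner (gamma z h) g) \<le> C * norm h" for g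
    using cmod_cinner_le by (metis mult.commute)
  then have "\<exists>K. \<forall>h\<in>UNIV. norm (gamma z h) \<le> K * norm h"
    by (rule weakly_bounded_imp_bounded)
  then show ?thesis
    using clinear_gamma gamma_in by (auto simp: bounded_op_def)
qed

text \<open>This supplies the bounded inverse of \<open>gamma z\<close>. Green's identity represents
  each functional \<open>cinner (\<Gamma>0 f) k\<close> by a fixed vector, so weak boundedness
  applies.\<close>

lemma bounded_\<Gamma>0: "bounded_op (\<NN> z) UNIV \<Gamma>0"
proof -
  have "\<exists>C. \<forall>f\<in>\<NN> z. cmod (cinner (\<Gamma>0 f) k) \<le> C * norm f" for k
  proof -
    \<comment> \<open>With \<open>\<Gamma>0 g = 0\<close> only the term
      \<open>cinner (\<Gamma>0 f) k\<close> survives on the boundary side, up to sign.\<close>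
    obtain g g' where g: "(g, g') \<in> adj A" "\<Gamma>0 g = 0" "\<Gamma>1 g = k"
      by (rule boundary_values)
    have "cinner (\<Gamma>0 f) k = cinner f (g' - cnj z *\<^sub>C g)" if "f \<in> \<NN> z" for f
      using green[of f "z *\<^sub>C f" g g'] that g
      by (simp add: in_defect_subspace_iff cinner_diff_right cinner_scaleC_left cinner_scaleC_right
          algebra_simps)
    then show ?thesis
      using cmod_cinner_le by (metis mult.commute)
  qed
  then have "\<exists>K. \<forall>f\<in>\<NN> z. norm (\<Gamma>0 f) \<le> K * norm f"
    by (rule weakly_bounded_imp_bounded)
  moreover have "clinear_on (\<NN> z) \<Gamma>0"
    unfolding clinear_on_def using \<Gamma>_linear(1,3) in_defect_subspace_iff by metis
  ultimately show ?thesis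
    by (auto simp: bounded_op_def)
qed

lemma same_hilbert_dim_defect:
  assumes "separable_hilbert TYPE('a)"
  shows "same_hilbert_dim (UNIV :: 'h set) (\<NN> z)"
proof -
  obtain K where "\<forall>f\<in>\<NN> z. norm (\<Gamma>0 f) \<le> K * norm f" and "clinear_on (\<NN> z) \<Gamma>0"
    using bounded_\<Gamma>0 by (auto simp: bounded_op_def)
  then show ?thesis
    using assms clinear_gamma range_gamma \<Gamma>0_gamma subspace_defect
    by (intro same_hilbert_dim_isomorphism[where \<gamma> = "gamma z" and \<delta> = \<Gamma>0]) auto
qed

end

text \<open>The operator (A0 - z0)(A0 - z)^{-1} equals I + (z - z0)(A0 - z)^{-1}. It carries the
  defect subspace at \<open>z0\<close> into the one at \<open>z\<close> and preserves
  \<open>\<Gamma>0\<close>, so uniqueness identifies the result with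
  \<open>gamma z h\<close>.\<close>

lemma gamma_transform:
  assumes z0: "z0 \<in> resolvent_set A0" and z: "z \<in> resolvent_set A0"
  shows "(gamma z0 h, gamma z h) \<in> (shift A0 z)\<inverse> O shift A0 z0"
proof -
  obtain R where R: "\<And>f g. (f, g + z *\<^sub>C f) \<in> A0 \<longleftrightarrow> f = R g"
    using z by (rule resolvent_setE) blast
  define u where "u = R (gamma z0 h)"
  define v where "v = gamma z0 h + (z - z0) *\<^sub>C u"
  have u: "(u, gamma z0 h + z *\<^sub>C u) \<in> A0"
    using R by (simp add: u_def)
  then have u': "(u, gamma z0 h + z *\<^sub>C u) \<in> adj A" "\<Gamma>0 u = 0"
    by (auto simp: in_ext0_iff)
  note w = adj_lin(4)[OF u'(1), of "z - z0"]
  have "z0 *\<^sub>C gamma z0 h + (z - z0) *\<^sub>C (gamma z0 h + z *\<^sub>C u) = z *\<^sub>C v"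
    by (simp add: v_def scaleC_add_right scaleC_scaleC cvec.scale_left_diff_distrib algebra_simps)
  then have "v \<in> \<NN> z"
    using adj_lin(2)[OF gamma_adj[OF z0, of h] w] by (simp add: in_defect_subspace_iff v_def)
  moreover have "\<Gamma>0 v = h"
    using \<Gamma>_linear(1)[OF gamma_adj[OF z0, of h] w] \<Gamma>_linear(3)[OF u'(1) u'(1)] u'(2) \<Gamma>0_gamma[OF z0]
    by (simp add: v_def)
  ultimately have "gamma z h = v"
    by (rule gamma_eqI[OF z])
  then have "(u, gamma z h) \<in> shift A0 z0"
    using u by (simp add: in_shift_iff v_def cvec.scale_left_diff_distrib)
  moreover have "(gamma z0 h, u) \<in> (shift A0 z)\<inverse>"
    using u by (simp add: in_shift_iff)
  ultimately show ?thesis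
    by blast
qed

lemma gamma_field_gamma:
  assumes "separable_hilbert TYPE('a)"
  shows "gamma_field A A0 gamma"
proof -
  \<comment> \<open>The point \<i> is the base point of the gamma-field; together with its negative
    it also gives the two deficiency indices.\<close>
  have i: "\<i> \<in> resolvent_set A0" and mi: "- \<i> \<in> resolvent_set A0"
    by (auto intro!: nonreal_in_resolvent_set self_adjoint_ext0)
  have "dim_eq_deficiency_number TYPE('h) A"
    using same_hilbert_dim_defect assms i mi by (simp add: dim_eq_deficiency_number_def)
  moreover have "self_adjoint_extension A A0"
    using self_adjoint_ext0 subset_ext0 by (simp add: self_adjoint_extension_def)
  moreover have "gamma \<i> (\<Gamma>0 f) = f" if "f \<in> \<NN> \<i>" for f
    using gamma_eqI[OF i that] by simp
  ultimately show ?thesis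
    using i bounded_gamma[OF i] bounded_\<Gamma>0[OF i] \<Gamma>0_gamma[OF i] gamma_transform[OF i]
    unfolding gamma_field_def by blast
qed

section \<open>The Weyl function and the Q-function identity\<close>

context
  fixes M
  assumes M: "weyl_function A \<Gamma>0 \<Gamma>1 M"
begin

text \<open>Every \<open>h\<close> is the boundary value of \<open>gamma z h\<close>, so the
  defining relation determines \<open>M z\<close> on the whole boundary space.\<close>

lemma weyl_eq: "z \<in> resolvent_set A0 \<Longrightarrow> M z h = \<Gamma>1 (gamma z h)"
  using M gamma_in \<Gamma>0_gamma unfolding weyl_function_def by metis

text \<open>The sesquilinear form of the Q-function identity: Green's identity for
  \<open>gamma z h\<close> and \<open>gamma \<zeta> k\<close>.\<close>

lemma weyl_green:
  assumes "z \<in> resolvent_set A0" "\<zeta> \<in> resolvent_set A0"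
  shows "(z - cnj \<zeta>) * cinner (gamma z h) (gamma \<zeta> k) = cinner (M z h) k - cinner h (M \<zeta> k)"
  using green[OF gamma_adj[OF assms(1), of h] gamma_adj[OF assms(2), of k]] assms
  by (simp add: weyl_eq \<Gamma>0_gamma cinner_scaleC_left cinner_scaleC_right left_diff_distrib)

text \<open>Choosing \<open>cnj z\<close> as the second point makes the factor on the left of
  \<open>weyl_green\<close> vanish.\<close>

lemma weyl_cnj:
  assumes "z \<in> resolvent_set A0"
  shows "cinner (M z h) k = cinner h (M (cnj z) k)"
  using weyl_green[OF assms cnj_in_resolvent_set[OF self_adjoint_ext0 assms], of h k] by simp

text \<open>\<open>M (cnj z)\<close> is an everywhere defined formal adjoint, which gives weak
  boundedness; linearity comes from \<open>gamma z\<close> and \<open>\<Gamma>1\<close>.\<close>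

lemma bounded_weyl:
  assumes z: "z \<in> resolvent_set A0"
  shows "bounded_op UNIV UNIV (M z)"
proof -
  have "\<exists>C. \<forall>h\<in>UNIV. cmod (cinner (M z h) k) \<le> C * norm h" for k
    using weyl_cnj[OF z] cmod_cinner_le by (metis mult.commute)
  then have "\<exists>K. \<forall>h\<in>UNIV. norm (M z h) \<le> K * norm h"
    by (rule weakly_bounded_imp_bounded)
  moreover have "clinear_on UNIV (M z)"
    using clinear_gamma[OF z] \<Gamma>_linear(2,4)[OF gamma_adj[OF z] gamma_adj[OF z]]
    by (simp add: clinear_on_def weyl_eq[OF z])
  ultimately show ?thesis
    by (simp add: bounded_op_def)
qed

lemma weyl_identity:
  assumes z: "z \<in> resolvent_set A0" and \<zeta>: "\<zeta> \<in> resolvent_set A0"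
  shows "M z h - bounded_adjoint (M \<zeta>) h = (z - cnj \<zeta>) *\<^sub>C bounded_adjoint (gamma \<zeta>) (gamma z h)"
proof -
  have adj: "bounded_adjoint (M \<zeta>) h = M (cnj \<zeta>) h"
    using weyl_cnj[OF \<zeta>] by (rule bounded_adjoint_eqI)
  show ?thesis
  \<comment> \<open>At \<open>z = cnj \<zeta>\<close> both sides vanish; elsewhere division by
    \<open>z - cnj \<zeta>\<close> yields an explicit value for the adjoint of
    \<open>gamma \<zeta>\<close> at \<open>gamma z h\<close>.\<close>
  proof (cases "z = cnj \<zeta>")
    case True
    then show ?thesis
      by (simp add: adj)
  next
    case False
    have "cinner (gamma \<zeta> k) (gamma z h) = cinner k (inverse (z - cnj \<zeta>) *\<^sub>C (M z h - M (cnj \<zeta>) h))" for k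
    proof -
      have "cinner k (M z h - M (cnj \<zeta>) h) = cnj (z - cnj \<zeta>) * cinner (gamma \<zeta> k) (gamma z h)"
        \<comment> \<open>The two points enter in exchanged order, since the adjoint is tested with
          \<open>gamma \<zeta> k\<close> in the first argument.\<close>
        using weyl_green[OF \<zeta> z, of k h] weyl_cnj[OF \<zeta>, of k h]
        by (simp add: cinner_diff_right algebra_simps)
      moreover have "cnj (z - cnj \<zeta>) \<noteq> 0"
        using False by (metis complex_cnj_zero_iff eq_iff_diff_eq_0)
      ultimately show ?thesis
        unfolding cinner_scaleC_right complex_cnj_inverse by simp
    qed
    then have "bounded_adjoint (gamma \<zeta>) (gamma z h) = inverse (z - cnj \<zeta>) *\<^sub>C (M z h - M (cnj \<zeta>) h)"
      by (rule bounded_adjoint_eqI)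
    then show ?thesis
      using False by (simp add: adj scaleC_scaleC)
  qed
qed

end

end

theorem theorem3p8:
  fixes A :: "'a::chilbert_space op"
    and \<Gamma>0 \<Gamma>1 :: "'a \<Rightarrow> 'h::chilbert_space"
    and M :: "complex \<Rightarrow> 'h \<Rightarrow> 'h"
  assumes "separable_hilbert TYPE('a)"
    and "linear_operator A" and "closed A" and "densely_defined A" and "symmetric_operator A"
    and "equal_deficiency_indices A"
    and "boundary_triplet A \<Gamma>0 \<Gamma>1"
    and "weyl_function A \<Gamma>0 \<Gamma>1 M"
  shows "Q_function A (ext0 A \<Gamma>0) M"
proof -
  interpret boundary_triplet_operator A \<Gamma>0 \<Gamma>1
    using assms by unfold_locales
  show ?thesis
    unfolding Q_function_def
    using bounded_weyl[OF assms(8)] weyl_identity[OF assms(8)] gamma_field_gamma[OF assms(1)]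
    by blast
qed

end
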